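(* Let $\mathbb{F}$ be a local field of characteristic distinct from $2$. Then the topological group $\mathrm{ST}^+(n,\mathbb{F})$ is minimal for every positive integer $n$.
   Context: A local field is a non-discrete locally compact (Hausdorff) topological field. $\mathrm{ST}^+(n,\mathbb{F})$ is the group of upper triangular $n\times n$ matrices over $\mathbb{F}$ of determinant $1$, with the pointwise topology inherited from $\mathbb{F}^{n^2}$. All topological groups are Hausdorff. A topological group $G$ is minimal if it admits no strictly coarser Hausdorff group topology. *)

theory Defs
  imports
    "HOL-Algebra.Group"
    "HOL-Analysis.Abstract_Topological_Spaces"
    "HOL-Analysis.Function_Topology"
    "Jordan_Normal_Form.Determinant"
begin

section \<open>Local fields\<close>

class topological_field = field + topological_ab_group_add + topological_semigroup_mult +
  assumes tendsto_inverse_nhds: "a \<noteq> 0 \<Longrightarrow> (inverse \<longlongrightarrow> inverse a) (nhds a)"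

class local_field = topological_field + t2_space +
  assumes locally_compact: "\<exists>U K. open U \<and> compact K \<and> x \<in> U \<and> U \<subseteq> K"
    and nondiscrete: "\<exists>S. \<not> open S"

lemma continuous_on_inverse_nonzero:
  "continuous_on (- {0}) (inverse :: 'a \<Rightarrow> 'a::topological_field)"
  by (auto simp: continuous_on_def at_within_def intro: tendsto_mono[OF inf_le1 tendsto_inverse_nhds])

lemma locally_compact_space_local_field:
  "locally_compact_space (euclidean :: 'a::local_field topology)"
  using locally_compact by (simp add: locally_compact_space_def) blast

lemma local_field_not_discrete:
  "(euclidean :: 'a::local_field topology) \<noteq> discrete_topology UNIV"
  by (metis nondiscrete open_openin openin_discrete_topology subset_UNIV)

instance real :: local_field
proof
  show "(inverse \<longlongrightarrow> inverse a) (nhds a)" if "a \<noteq> 0" for a :: real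
    using tendsto_inverse[OF tendsto_ident_at that, of UNIV]
    by (simp only: tendsto_at_iff_tendsto_nhds)
  show "\<exists>U K. open U \<and> compact K \<and> x \<in> U \<and> U \<subseteq> K" for x :: real
    by (intro exI[of _ "{x - 1<..<x + 1}"] exI[of _ "{x - 1..x + 1}"]) auto
  show "\<exists>S :: real set. \<not> open S"
    using not_open_singleton by blast
qed


section \<open>Minimal topological groups\<close>

definition group_topology :: "('a, 'b) monoid_scheme \<Rightarrow> 'a topology \<Rightarrow> bool" where
  "group_topology G T \<longleftrightarrow>
     topspace T = carrier G \<and>
     continuous_map (prod_topology T T) T (\<lambda>(x, y). x \<otimes>\<^bsub>G\<^esub> y) \<and>
     continuous_map T T (\<lambda>x. inv\<^bsub>G\<^esub> x)"

definition hausdorff_group_topology :: "('a, 'b) monoid_scheme \<Rightarrow> 'a topology \<Rightarrow> bool" where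
  "hausdorff_group_topology G T \<longleftrightarrow> group_topology G T \<and> Hausdorff_space T"

definition strictly_coarser :: "'a topology \<Rightarrow> 'a topology \<Rightarrow> bool" where
  "strictly_coarser S T \<longleftrightarrow> {U. openin S U} \<subset> {U. openin T U}"

definition minimal_topological_group :: "('a, 'b) monoid_scheme \<Rightarrow> 'a topology \<Rightarrow> bool" where
  "minimal_topological_group G T \<longleftrightarrow>
     group G \<and> hausdorff_group_topology G T \<and>
     \<not> (\<exists>S. hausdorff_group_topology G S \<and> strictly_coarser S T)"


section \<open>The group of upper triangular matrices of determinant 1\<close>

definition ST_plus :: "nat \<Rightarrow> 'a::field mat monoid" where
  "ST_plus n =
     \<lparr>carrier = {A \<in> carrier_mat n n. upper_triangular A \<and> det A = 1},
      monoid.mult = (*), one = 1\<^sub>m n\<rparr>"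

text \<open>
  The space of \<open>n \<times> n\<close> matrices is topologized as the power of the field indexed by
  the \<open>n\<^sup>2\<close> pairs of indices (points of a product topology are extensional functions,
  whence the \<open>restrict\<close>).
\<close>

definition mat_topology :: "nat \<Rightarrow> 'a::topological_space mat topology" where
  "mat_topology n =
     pullback_topology (carrier_mat n n)
       (\<lambda>A. restrict (\<lambda>ij. A $$ ij) ({..<n} \<times> {..<n}))
       (product_topology (\<lambda>_. euclidean) ({..<n} \<times> {..<n}))"

definition ST_plus_topology :: "nat \<Rightarrow> 'a::topological_field mat topology" where
  "ST_plus_topology n = subtopology (mat_topology n) (carrier (ST_plus n))"

end

(*
  Let S be a Hausdorff group topology coarser than the usual one T, and let n = N + 1.
  If the corner matrices 1 + x_b E_{0N} tend to 1 in S, then so do 1 + 4 a_b x_b E_{0N} whenever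
  a_b tends to 0 in the field: conjugating by diag(t, 1, ..., 1, 1/t) multiplies x_b by t^2, and
  (1 + a)^2 - (1 - a)^2 = 4 a. Taking a_b = 1/x_b shows that x_b cannot escape to infinity, hence by
  local compactness and the Hausdorff property x_b tends to 0, so S = T on the corner subgroup.
  Commutators with elementary matrices extend this to the group of the last column. For g tending
  to 1 in S, conjugation of the last column and the commutator with diag(s, ..., s, s^(-N)) show that
  all quotients g_ij / g_NN tend to the entries of the identity, and det g = 1 forces g_NN^n to tend
  to 1. A cluster point z of g_NN makes the scalar matrix z a cluster point of g for T, hence for S,
  so z = 1.
*)
theory Submission
  imports Defs
begin

section \<open>Compactness in local fields\<close>

lemma tendsto_inverse_field:
  fixes a :: "'a::topological_field"
  assumes "(f \<longlongrightarrow> a) F" "a \<noteq> 0"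
  shows "((\<lambda>x. inverse (f x)) \<longlongrightarrow> inverse a) F"
  using tendsto_compose_filtermap[of inverse f] tendsto_inverse_nhds[OF assms(2)] assms(1)
  by (metis filterlim_compose)

lemma tendsto_divide_field:
  fixes a :: "'a::topological_field"
  assumes "(f \<longlongrightarrow> a) F" "(g \<longlongrightarrow> b) F" "b \<noteq> 0"
  shows "((\<lambda>x. f x / g x) \<longlongrightarrow> a / b) F"
  unfolding divide_inverse by (intro tendsto_mult tendsto_inverse_field assms)

lemma tendsto_power_field:
  fixes a :: "'a::topological_field"
  assumes "(f \<longlongrightarrow> a) F"
  shows "((\<lambda>x. f x ^ n) \<longlongrightarrow> a ^ n) F"
  by (induction n) (auto intro!: tendsto_mult assms)

lemma tendsto_prod_field:
  fixes a :: "'i \<Rightarrow> 'a::topological_field"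
  assumes "\<And>i. i \<in> I \<Longrightarrow> ((\<lambda>x. f x i) \<longlongrightarrow> a i) F"
  shows "((\<lambda>x. prod (f x) I) \<longlongrightarrow> prod a I) F"
  using assms by (induction I rule: infinite_finite_induct) (auto intro!: tendsto_mult)

section \<open>Cluster points as limits along finer filters\<close>

lemma filterlim_mono_domain: "filterlim f G F \<Longrightarrow> F' \<le> F \<Longrightarrow> filterlim f G F'"
  by (rule filterlim_mono) auto

text \<open>Finer filters play the part of subnets: adding to \<open>F\<close> the preimages of
  neighbourhoods of \<open>z\<close> forces convergence, and the result is proper because otherwise
  the image of \<open>F\<close> would avoid a neighbourhood of \<open>z\<close>.\<close>

lemma cluster_subfilter:
  fixes f :: "'b \<Rightarrow> 'a::topological_space"
  assumes "inf (nhds z) (filtermap f F) \<noteq> bot"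
  obtains F' where "F' \<le> F" "F' \<noteq> bot" "(f \<longlongrightarrow> z) F'"
proof
  show "inf F (filtercomap f (nhds z)) \<le> F" by simp
  show "(f \<longlongrightarrow> z) (inf F (filtercomap f (nhds z)))"
    unfolding filterlim_iff_le_filtercomap by simp
  show "inf F (filtercomap f (nhds z)) \<noteq> bot"
  proof
    assume "inf F (filtercomap f (nhds z)) = bot"
    then obtain P Q where PQ: "eventually P F" "eventually Q (filtercomap f (nhds z))"
      "\<And>x. P x \<and> Q x \<Longrightarrow> False"
      by (auto simp: trivial_limit_def eventually_inf)
    then obtain R where R: "eventually R (nhds z)" "\<And>x. R (f x) \<Longrightarrow> Q x"
      by (auto simp: eventually_filtercomap)
    have "eventually (\<lambda>y. \<not> R y) (filtermap f F)"
      unfolding eventually_filtermap by (rule eventually_mono[OF PQ(1)]) (use PQ R in blast)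
    with R(1) have "eventually (\<lambda>y. False) (inf (nhds z) (filtermap f F))"
      unfolding eventually_inf by blast
    with assms show False by (simp add: trivial_limit_def)
  qed
qed

lemma compact_subfilter:
  fixes f :: "'b \<Rightarrow> 'a::topological_space"
  assumes "compact K" "F \<noteq> bot" "eventually (\<lambda>x. f x \<in> K) F"
  obtains z F' where "z \<in> K" "F' \<le> F" "F' \<noteq> bot" "(f \<longlongrightarrow> z) F'"
proof -
  have "eventually (\<lambda>y. y \<in> K) (filtermap f F)"
    using assms(3) by (simp add: eventually_filtermap)
  moreover have "filtermap f F \<noteq> bot"
    using assms(2) by (simp add: filtermap_bot_iff)
  ultimately obtain z where z: "z \<in> K" "inf (nhds z) (filtermap f F) \<noteq> bot"
    using assms(1) unfolding compact_filter by blast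
  from z(2) obtain F' where "F' \<le> F" "F' \<noteq> bot" "(f \<longlongrightarrow> z) F'"
    by (rule cluster_subfilter)
  with z(1) show thesis by (rule that)
qed

text \<open>Serves proofs by contradiction: the failure of an eventual property becomes a proper
  filter along which its negation holds eventually.\<close>

lemma frequently_subfilter:
  assumes "frequently P F"
  obtains F' where "F' \<le> F" "F' \<noteq> bot" "eventually P F'"
proof
  show "inf F (principal {x. P x}) \<le> F" by simp
  show "inf F (principal {x. P x}) \<noteq> bot"
    using assms by (simp add: trivial_limit_def eventually_inf_principal frequently_def)
  show "eventually P (inf F (principal {x. P x}))"
    by (simp add: eventually_inf_principal)
qed

section \<open>Compactness of the projective line over a local field\<close>

lemma at_local_field_ne_bot: "at (0::'a::local_field) \<noteq> bot"
proof
  assume "at (0::'a) = bot"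
  then have o: "open {0::'a}" by (simp add: at_eq_bot_iff)
  \<comment> \<open>Translating the open singleton at \<open>0\<close> makes every singleton open,
    hence every set.\<close>
  have "open {a}" for a :: 'a
  proof -
    have "((\<lambda>x. x - a) \<longlongrightarrow> a - a) (nhds a)"
      by (intro tendsto_diff tendsto_const filterlim_ident)
    then have "eventually (\<lambda>x. x - a \<in> {0}) (nhds a)"
      using topological_tendstoD[OF _ o] by fastforce
    then have "eventually (\<lambda>x. x = a) (nhds a)" by eventually_elim simp
    then obtain S where "open S" "a \<in> S" "\<forall>x\<in>S. x = a" unfolding eventually_nhds by blast
    then have "S = {a}" by blast
    with \<open>open S\<close> show ?thesis by blast
  qed
  then have "open S" for S :: "'a set"
    using open_Union[of "(\<lambda>x. {x}) ` S"] by auto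
  with nondiscrete show False by blast
qed

text \<open>\<open>M\<close> plays the role of the closed unit ball.\<close>

lemma local_field_compact_monoid:
  obtains M :: "'a::local_field set" where "compact M" "0 \<in> interior M" "1 \<in> M"
    "\<And>a b. a \<in> M \<Longrightarrow> b \<in> M \<Longrightarrow> a * b \<in> M"
proof -
  obtain U C :: "'a set" where UC: "open U" "compact C" "0 \<in> U" "U \<subseteq> C"
    using locally_compact[of "0::'a"] by blast
  \<comment> \<open>Adjoining \<open>1\<close> gives \<open>a = a * 1\<close>, which puts the
    multiplicative stabilizer \<open>M\<close> of \<open>K\<close> inside the compact set
    \<open>K\<close>.\<close>
  define K where "K = insert 1 C"
  have K: "compact K" "1 \<in> K" "U \<subseteq> K"
    using UC by (auto simp: K_def)
  define M where "M = {a. \<forall>k\<in>K. a * k \<in> K}"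
  have sub: "M \<subseteq> K" using K(2) by (force simp: M_def)
  have "closed M"
  proof -
    have "closed ((\<lambda>a. a * k) -` K)" for k
      by (rule continuous_closed_vimage)
         (auto simp: compact_imp_closed[OF K(1)] isCont_def intro!: tendsto_mult)
    moreover have "M = (\<Inter>k\<in>K. (\<lambda>a. a * k) -` K)" by (auto simp: M_def)
    ultimately show ?thesis by auto
  qed
  then have "compact M"
    using compact_Int_closed[OF K(1)] sub by (metis inf.absorb2)
  \<comment> \<open>If elements \<open>a\<close> outside \<open>M\<close> approached
    \<open>0\<close>, witnesses \<open>k a\<close> in \<open>K\<close> with \<open>a * k a\<close>
    outside \<open>K\<close> would cluster at some \<open>z\<close>; then \<open>a * k a\<close>
    tends to \<open>0 * z = 0\<close> and ends up in \<open>U \<subseteq> K\<close>.\<close>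
  moreover have "eventually (\<lambda>a. a \<in> M) (nhds 0)"
  proof (rule ccontr)
    assume "\<not> ?thesis"
    then have "frequently (\<lambda>a. a \<notin> M) (nhds 0)" by (simp add: frequently_def)
    then obtain F where F: "F \<le> nhds 0" "F \<noteq> bot" "eventually (\<lambda>a. a \<notin> M) F"
      by (rule frequently_subfilter)
    have "\<forall>a. \<exists>k. a \<notin> M \<longrightarrow> k \<in> K \<and> a * k \<notin> K" by (auto simp: M_def)
    then obtain k where k: "\<And>a. a \<notin> M \<Longrightarrow> k a \<in> K \<and> a * k a \<notin> K" by metis
    obtain z F' where F': "F' \<le> F" "F' \<noteq> bot" "(k \<longlongrightarrow> z) F'"
      using compact_subfilter[OF K(1) F(2), of k] F(3) k by (metis (mono_tags, lifting) eventually_mono)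
    have "((\<lambda>a. a) \<longlongrightarrow> 0) F'"
      using F(1) F'(1) by (simp add: filterlim_def)
    from tendsto_mult[OF this F'(3)] have "eventually (\<lambda>a. a * k a \<in> U) F'"
      using topological_tendstoD UC by fastforce
    moreover have "eventually (\<lambda>a. a \<notin> M) F'" using F(3) F'(1) by (simp add: filter_leD)
    ultimately have "eventually (\<lambda>a. False) F'"
      by eventually_elim (use k K(3) in blast)
    with F'(2) show False by (simp add: trivial_limit_def)
  qed
  then have "0 \<in> interior M" unfolding eventually_nhds interior_def by blast
  moreover have "1 \<in> M" "\<And>a b. a \<in> M \<Longrightarrow> b \<in> M \<Longrightarrow> a * b \<in> M"
    by (auto simp: M_def mult.assoc)
  ultimately show thesis using that by blast
qed

lemma eventually_in_nhd_0: "0 \<in> interior M \<Longrightarrow> (f \<longlongrightarrow> 0) F \<Longrightarrow> eventually (\<lambda>x. f x \<in> M) F"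
  using topological_tendstoD[OF _ open_interior] interior_subset by (blast intro: eventually_mono)

text \<open>
  Compactness of the projective line over a local field. An element \<open>p\<close> of \<open>M\<close> with
  \<open>inverse p \<notin> M\<close> has powers clustering at \<open>0\<close> only; normalizing \<open>x b\<close> by the least power of
  \<open>p\<close> that moves it into \<open>M\<close> lands outside the neighbourhood \<open>p M\<close> of \<open>0\<close>.
\<close>

lemma local_field_cluster:
  fixes x :: "'b \<Rightarrow> 'a::local_field"
  assumes F: "F \<noteq> bot"
  obtains z F' where "F' \<le> F" "F' \<noteq> bot" "(x \<longlongrightarrow> z) F'"
  | F' where "F' \<le> F" "F' \<noteq> bot" "eventually (\<lambda>b. x b \<noteq> 0) F'" "((\<lambda>b. inverse (x b)) \<longlongrightarrow> 0) F'"
proof -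
  obtain M :: "'a set" where M: "compact M" "0 \<in> interior M" "1 \<in> M"
    and mult: "\<And>a b. a \<in> M \<Longrightarrow> b \<in> M \<Longrightarrow> a * b \<in> M"
    using local_field_compact_monoid by blast
  have M0: "0 \<in> M" using M(2) interior_subset by blast
  have pow: "a ^ n \<in> M" if "a \<in> M" for a n
    using that by (induction n) (auto simp: M mult)
  \<comment> \<open>Without such a \<open>p\<close>, all nonzero elements near \<open>0\<close> have
    inverses in the compact set \<open>M\<close>; along a filter where these inverses converge,
    \<open>a * inverse a\<close> tends both to \<open>0\<close> and to \<open>1\<close>.\<close>
  obtain p where p: "p \<in> M" "p \<noteq> 0" "inverse p \<notin> M"
  proof (rule ccontr)
    assume *: "\<not> thesis"
    have id: "((\<lambda>a. a) \<longlongrightarrow> 0) (at (0::'a))" by (rule tendsto_ident_at)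
    have "eventually (\<lambda>a. a \<in> M \<and> a \<noteq> 0) (at (0::'a))"
      using eventually_in_nhd_0[OF M(2) id] by (auto simp: eventually_at_filter elim: eventually_mono)
    then have "eventually (\<lambda>a. inverse a \<in> M) (at (0::'a))"
      by eventually_elim (use * that in blast)
    from compact_subfilter[OF M(1) at_local_field_ne_bot this] obtain z G
      where G: "G \<le> at (0::'a)" "G \<noteq> bot" "(inverse \<longlongrightarrow> z) G" by metis
    have "((\<lambda>a. a * inverse a) \<longlongrightarrow> 0 * z) G"
      using tendsto_mult[OF filterlim_mono_domain[OF id G(1)] G(3)] .
    moreover have "((\<lambda>a. a * inverse a) \<longlongrightarrow> 1) G"
    proof (rule tendsto_eventually)
      have "eventually (\<lambda>a. a \<noteq> 0) (at (0::'a))" by (simp add: eventually_at_filter)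
      then have "eventually (\<lambda>a. a \<noteq> 0) G" using G(1) filter_leD by blast
      then show "eventually (\<lambda>a. a * inverse a = 1) G" by eventually_elim simp
    qed
    ultimately show False using tendsto_unique[OF G(2)] by force
  qed
  have absorb: "\<exists>n. p ^ n * y \<in> M" for y
  proof -
    obtain w G where G: "G \<le> sequentially" "G \<noteq> bot" "((\<lambda>n. p ^ n) \<longlongrightarrow> w) G"
      using compact_subfilter[OF M(1) sequentially_bot, of "\<lambda>n. p ^ n"] pow[OF p(1)]
      by (metis (no_types, lifting) always_eventually)
    have "w = 0"
    proof (rule ccontr)
      assume w: "w \<noteq> 0"
      \<comment> \<open>The extra factor \<open>p\<close> in the denominator makes the limit
        \<open>inverse p\<close>, outside the closed set \<open>M\<close>. Two powers near
        \<open>w\<close> with exponents \<open>m > n\<close> have as quotient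
        \<open>p ^ (m - n - 1)\<close>, which lies in \<open>M\<close>.\<close>
      have lim: "((\<lambda>ab. fst ab / (snd ab * p)) \<longlongrightarrow> w / (w * p)) (nhds w \<times>\<^sub>F nhds w)"
        by (intro tendsto_divide_field tendsto_mult tendsto_const filterlim_fst filterlim_snd)
           (use w p in auto)
      have "open (- M)" using M(1) by (simp add: compact_imp_closed open_Compl)
      moreover have "w / (w * p) \<in> - M" using w p by (simp add: field_simps)
      ultimately have "eventually (\<lambda>ab. fst ab / (snd ab * p) \<in> - M) (nhds w \<times>\<^sub>F nhds w)"
        by (rule topological_tendstoD[OF lim])
      then obtain N where N: "eventually N (nhds w)"
        "\<And>a b. N a \<Longrightarrow> N b \<Longrightarrow> a / (b * p) \<notin> M"
        unfolding eventually_prod_same by auto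
      have ev: "eventually (\<lambda>n. N (p ^ n)) G" using G(3) N(1) by (rule eventually_compose_filterlim[rotated])
      obtain n where n: "N (p ^ n)"
        using eventually_happens[OF ev] G(2) by auto
      have "eventually (\<lambda>m. m > n) G" using G(1) eventually_gt_at_top filter_leD by blast
      with ev have "eventually (\<lambda>m. N (p ^ m) \<and> m > n) G" by eventually_elim simp
      then obtain m where m: "N (p ^ m)" "m > n"
        using eventually_happens G(2) by (metis (no_types, lifting) trivial_limit_def)
      then obtain k where k: "m = n + Suc k" using less_imp_Suc_add by auto
      have "p ^ m / (p ^ n * p) = p ^ k" using p(2) by (simp add: k power_add)
      with N(2)[OF m(1) n] pow[OF p(1), of k] show False by simp
    qed
    then have "((\<lambda>n. p ^ n * y) \<longlongrightarrow> 0 * y) G" using G(3) by (intro tendsto_mult tendsto_const) auto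
    then have "eventually (\<lambda>n. p ^ n * y \<in> M) G" using eventually_in_nhd_0[OF M(2)] by simp
    then show ?thesis using G(2) eventually_happens by blast
  qed
  show thesis
  proof (cases "frequently (\<lambda>b. x b \<in> M) F")
    case True
    then obtain F1 where F1: "F1 \<le> F" "F1 \<noteq> bot" "eventually (\<lambda>b. x b \<in> M) F1"
      by (rule frequently_subfilter)
    from compact_subfilter[OF M(1) F1(2,3)] that(1) F1(1) show thesis by (metis order_trans)
  next
    case False
    then have out: "eventually (\<lambda>b. x b \<notin> M) F" by (simp add: frequently_def)
    define k where "k b = (LEAST n. p ^ n * x b \<in> M)" for b
    have kM: "p ^ k b * x b \<in> M" for b
      unfolding k_def by (rule LeastI_ex) (rule absorb)
    obtain F1 z where F1: "F1 \<le> F" "F1 \<noteq> bot" "((\<lambda>b. p ^ k b * x b) \<longlongrightarrow> z) F1"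
      using compact_subfilter[OF M(1) F, of "\<lambda>b. p ^ k b * x b"] kM
      by (metis (no_types, lifting) always_eventually)
    obtain F2 w where F2: "F2 \<le> F1" "F2 \<noteq> bot" "((\<lambda>b. p ^ k b) \<longlongrightarrow> w) F2"
      using compact_subfilter[OF M(1) F1(2), of "\<lambda>b. p ^ k b"] pow[OF p(1)]
      by (metis (no_types, lifting) always_eventually)
    have F2F: "F2 \<le> F" using F2 F1 by simp
    have limz: "((\<lambda>b. p ^ k b * x b) \<longlongrightarrow> z) F2" using filterlim_mono_domain F1 F2 by blast
    have out2: "eventually (\<lambda>b. x b \<notin> M) F2" using out F2F by (simp add: filter_leD)
    \<comment> \<open>If \<open>z = 0\<close>, dividing the normalized values by \<open>p\<close>
      keeps them in \<open>M\<close> eventually. Since \<open>x b\<close> is outside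
      \<open>M\<close>, \<open>k b\<close> is positive, so the exponent \<open>k b - 1\<close>
      contradicts minimality.\<close>
    have "z \<noteq> 0"
    proof
      assume "z = 0"
      then have "((\<lambda>b. inverse p * (p ^ k b * x b)) \<longlongrightarrow> inverse p * 0) F2"
        using limz by (intro tendsto_mult tendsto_const) auto
      then have "eventually (\<lambda>b. inverse p * (p ^ k b * x b) \<in> M) F2"
        using eventually_in_nhd_0[OF M(2)] by simp
      with out2 have "eventually (\<lambda>b. False) F2"
      proof eventually_elim
        case (elim b)
        then have "k b \<noteq> 0" using kM[of b] by (metis mult_1 power_0)
        then obtain j where j: "k b = Suc j" using not0_implies_Suc by blast
        have "inverse p * (p ^ k b * x b) = p ^ j * x b" unfolding j using p(2) by simp
        then have "p ^ j * x b \<in> M" using elim by (simp only:)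
        then have "k b \<le> j" unfolding k_def by (rule Least_le)
        with j show ?case by simp
      qed
      with F2(2) show False by (simp add: trivial_limit_def)
    qed
    show thesis
    \<comment> \<open>As the normalized values converge to \<open>z \<noteq> 0\<close>, the limit
      \<open>w\<close> of the normalizing powers decides: for \<open>w = 0\<close> the values
      \<open>x b\<close> escape to infinity, otherwise they converge to
      \<open>z / w\<close>.\<close>
    proof (cases "w = 0")
      case True
      have "((\<lambda>b. p ^ k b * inverse (p ^ k b * x b)) \<longlongrightarrow> w * inverse z) F2"
        by (intro tendsto_mult tendsto_inverse_field F2 limz \<open>z \<noteq> 0\<close>)
      then have "((\<lambda>b. inverse (x b)) \<longlongrightarrow> 0) F2"
        using p(2) True by (simp add: field_simps)
      moreover have "eventually (\<lambda>b. x b \<noteq> 0) F2"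
        using out2 by (rule eventually_mono) (use M0 in auto)
      ultimately show thesis using that(2) F2F F2(2) by blast
    next
      case False
      have "((\<lambda>b. p ^ k b * x b / p ^ k b) \<longlongrightarrow> z / w) F2"
        by (intro tendsto_divide_field F2 limz False)
      then have "(x \<longlongrightarrow> z / w) F2" using p(2) by simp
      then show thesis using that(1) F2F F2(2) by blast
    qed
  qed
qed

text \<open>By compactness of the projective line it suffices to identify finite cluster points and
  to exclude infinity: a filter staying outside a neighbourhood of \<open>w\<close> would have a
  cluster point of one of the two kinds.\<close>

lemma local_field_tendstoI:
  fixes x :: "'b \<Rightarrow> 'a::local_field"
  assumes fin: "\<And>G z. G \<le> F \<Longrightarrow> G \<noteq> bot \<Longrightarrow> (x \<longlongrightarrow> z) G \<Longrightarrow> z = w"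
    and inf: "\<And>G. G \<le> F \<Longrightarrow> G \<noteq> bot \<Longrightarrow> eventually (\<lambda>b. x b \<noteq> 0) G \<Longrightarrow>
      ((\<lambda>b. inverse (x b)) \<longlongrightarrow> 0) G \<Longrightarrow> False"
  shows "(x \<longlongrightarrow> w) F"
proof (rule topological_tendstoI, rule ccontr)
  fix S assume S: "open S" "w \<in> S" and "\<not> eventually (\<lambda>b. x b \<in> S) F"
  then have "frequently (\<lambda>b. x b \<notin> S) F" by (simp add: frequently_def)
  then obtain G where G: "G \<le> F" "G \<noteq> bot" "eventually (\<lambda>b. x b \<notin> S) G"
    by (rule frequently_subfilter)
  from G(2) show False
  proof (cases rule: local_field_cluster[of G x])
    case (1 z H)
    then have "z = w" using fin G(1) by (meson order_trans)
    then have "eventually (\<lambda>b. x b \<in> S) H" using 1 S by (auto intro: topological_tendstoD)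
    moreover have "eventually (\<lambda>b. x b \<notin> S) H" using 1 G(3) by (simp add: filter_leD)
    ultimately have "eventually (\<lambda>b. False) H" by eventually_elim simp
    then show False using 1 by (simp add: trivial_limit_def)
  next
    case (2 H)
    then show False using inf G(1) by (meson order_trans)
  qed
qed

section \<open>The topological group of triangular matrices\<close>

lemma ST_plus_simps [simp]:
  "monoid.mult (ST_plus n) = (*)" "one (ST_plus n) = 1\<^sub>m n"
  by (simp_all add: ST_plus_def)

lemma ST_plus_iff:
  "A \<in> carrier (ST_plus n) \<longleftrightarrow> A \<in> carrier_mat n n \<and>
    (\<forall>i<n. \<forall>j<i. A $$ (i, j) = 0) \<and> (\<Prod>i<n. A $$ (i, i)) = (1::'a::field)"
  using det_upper_triangular[of A n]
  by (auto simp: ST_plus_def prod_list_diag_prod upper_triangular_def lessThan_atLeast0)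

lemma ST_plus_diag_nz:
  assumes "A \<in> carrier (ST_plus n)" "i < n"
  shows "A $$ (i, i) \<noteq> 0"
proof
  assume "A $$ (i, i) = 0"
  then have "(\<Prod>i<n. A $$ (i, i)) = 0" using assms(2) by (intro prod_zero) auto
  with assms(1) show False by (simp add: ST_plus_iff)
qed

lemma index_mult_mat_sum:
  assumes "A \<in> carrier_mat n n" "B \<in> carrier_mat n n" "i < n" "j < n"
  shows "(A * B) $$ (i, j) = (\<Sum>k<n. A $$ (i, k) * B $$ (k, j))"
  using assms by (auto simp: scalar_prod_def lessThan_atLeast0)

text \<open>Back substitution from the last row upwards: in entry \<open>(i, j)\<close> of
  \<open>A * B\<close>, terms with \<open>k < i\<close> vanish by triangularity and those with
  \<open>k > i\<close> by induction, leaving \<open>A $$ (i, i) * B $$ (i, j) = 0\<close>.\<close>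

lemma upper_triangular_inverse:
  fixes A B :: "'a::field mat"
  assumes A: "A \<in> carrier_mat n n" and B: "B \<in> carrier_mat n n" and AB: "A * B = 1\<^sub>m n"
    and ut: "\<And>i j. i < n \<Longrightarrow> j < i \<Longrightarrow> A $$ (i, j) = 0" and nz: "\<And>i. i < n \<Longrightarrow> A $$ (i, i) \<noteq> 0"
    and ij: "i < n" "j < i"
  shows "B $$ (i, j) = 0"
  using ij
proof (induction "n - i" arbitrary: i rule: less_induct)
  case less
  have "A $$ (i, k) * B $$ (k, j) = (if k = i then A $$ (i, i) * B $$ (i, j) else 0)" if "k < n" for k
    using less that ut[of i k] by (cases k i rule: linorder_cases) auto
  then have "(\<Sum>k<n. A $$ (i, k) * B $$ (k, j)) = (\<Sum>k<n. if k = i then A $$ (i, i) * B $$ (i, j) else 0)"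
    by (intro sum.cong) auto
  moreover have "(A * B) $$ (i, j) = (\<Sum>k<n. A $$ (i, k) * B $$ (k, j))"
    by (rule index_mult_mat_sum[OF A B]) (use less.prems in auto)
  ultimately have "(A * B) $$ (i, j) = A $$ (i, i) * B $$ (i, j)"
    using less.prems by simp
  then show ?case using AB less.prems nz[of i] by simp
qed

text \<open>Determinant \<open>1\<close> makes the adjugate the inverse; its entries are polynomials
  in those of \<open>A\<close>, whence the continuity of inversion below.\<close>

lemma adj_mat_ST_plus:
  fixes A :: "'a::field mat"
  assumes "A \<in> carrier (ST_plus n)"
  shows "adj_mat A \<in> carrier (ST_plus n)" "A * adj_mat A = 1\<^sub>m n" "adj_mat A * A = 1\<^sub>m n"
proof -
  have A: "A \<in> carrier_mat n n" "det A = 1" using assms by (auto simp: ST_plus_def)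
  note adj = adj_mat[OF A(1)]
  show 1: "A * adj_mat A = 1\<^sub>m n" and "adj_mat A * A = 1\<^sub>m n" using adj A(2) by auto
  have "upper_triangular (adj_mat A)"
    using upper_triangular_inverse[OF A(1) adj(1) 1] assms ST_plus_diag_nz[OF assms] adj(1)
    by (auto simp: ST_plus_iff)
  moreover have "det (adj_mat A) = 1"
    using det_mult[OF A(1) adj(1)] A(2) 1 by simp
  ultimately show "adj_mat A \<in> carrier (ST_plus n)" using adj(1) by (simp add: ST_plus_def)
qed

lemma ST_plus_mult_closed:
  fixes A B :: "'a::field mat"
  assumes "A \<in> carrier (ST_plus n)" "B \<in> carrier (ST_plus n)"
  shows "A * B \<in> carrier (ST_plus n)"
proof -
  have c: "A \<in> carrier_mat n n" "B \<in> carrier_mat n n" using assms by (auto simp: ST_plus_def)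
  have "(A * B) $$ (i, j) = 0" if "i < n" "j < i" for i j
  proof -
    have "A $$ (i, k) * B $$ (k, j) = 0" if "k < n" for k
      using \<open>i < n\<close> \<open>j < i\<close> that assms by (cases "k < i") (auto simp: ST_plus_iff)
    with that show ?thesis
      by (subst index_mult_mat_sum[OF c]) (auto intro: sum.neutral)
  qed
  then have "upper_triangular (A * B)" using c by auto
  then show ?thesis
    using assms c det_mult[OF c] by (simp add: ST_plus_def)
qed

lemma group_ST_plus: "group (ST_plus n :: 'a::field mat monoid)"
proof (rule groupI)
  show "\<exists>B\<in>carrier (ST_plus n). B \<otimes>\<^bsub>ST_plus n\<^esub> A = \<one>\<^bsub>ST_plus n\<^esub>"
    if "A \<in> carrier (ST_plus n)" for A :: "'a mat"
    using adj_mat_ST_plus[OF that] by auto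
  show "A \<otimes>\<^bsub>ST_plus n\<^esub> B \<otimes>\<^bsub>ST_plus n\<^esub> C = A \<otimes>\<^bsub>ST_plus n\<^esub> (B \<otimes>\<^bsub>ST_plus n\<^esub> C)"
    if "A \<in> carrier (ST_plus n)" "B \<in> carrier (ST_plus n)" "C \<in> carrier (ST_plus n)" for A B C :: "'a mat"
    using that by (auto simp: ST_plus_def intro: assoc_mult_mat)
  show "\<one>\<^bsub>ST_plus n\<^esub> \<in> carrier (ST_plus n :: 'a mat monoid)" by (simp add: ST_plus_def)
  show "\<one>\<^bsub>ST_plus n\<^esub> \<otimes>\<^bsub>ST_plus n\<^esub> A = A" if "A \<in> carrier (ST_plus n)" for A :: "'a mat"
    using that by (auto simp: ST_plus_def)
qed (simp add: ST_plus_mult_closed)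

lemma inv_ST_plus:
  fixes A :: "'a::field mat"
  assumes "A \<in> carrier (ST_plus n)"
  shows "inv\<^bsub>ST_plus n\<^esub> A = adj_mat A"
  using group.inv_equality[OF group_ST_plus] adj_mat_ST_plus[OF assms] assms by simp

section \<open>Entrywise convergence of matrices and continuity of the group operations\<close>

lemma limitin_pullback_topology:
  assumes "f ` A \<subseteq> topspace T"
  shows "limitin (pullback_topology A f T) g l F \<longleftrightarrow>
    l \<in> A \<and> eventually (\<lambda>x. g x \<in> A) F \<and> limitin T (\<lambda>x. f (g x)) (f l) F"
  (is "?L \<longleftrightarrow> ?R")
proof
  assume L: ?L
  have l: "l \<in> A" using limitin_topspace[OF L] by (simp add: topspace_pullback_topology)
  have op: "openin (pullback_topology A f T) (f -` U \<inter> A)" if "openin T U" for U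
    using that by (auto simp: openin_pullback_topology)
  have ev: "eventually (\<lambda>x. g x \<in> f -` U \<inter> A) F" if "openin T U" "f l \<in> U" for U
    using limitinD[OF L op] that l by auto
  have "eventually (\<lambda>x. g x \<in> A) F"
    using ev[of "topspace T"] assms l by (auto simp: image_subset_iff elim: eventually_mono)
  moreover have "limitin T (\<lambda>x. f (g x)) (f l) F"
    using assms l ev by (auto simp: limitin_def eventually_conj_iff)
  ultimately show ?R using l by simp
next
  assume R: ?R
  show ?L
    unfolding limitin_def
  proof (intro conjI allI impI)
    show "l \<in> topspace (pullback_topology A f T)"
      using R assms by (auto simp: topspace_pullback_topology)
    fix U assume "openin (pullback_topology A f T) U \<and> l \<in> U"
    then obtain V where V: "openin T V" "U = f -` V \<inter> A" "l \<in> U"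
      by (auto simp: openin_pullback_topology)
    then have "eventually (\<lambda>x. f (g x) \<in> V) F" using R by (auto simp: limitin_def)
    with R have "eventually (\<lambda>x. f (g x) \<in> V \<and> g x \<in> A) F" by (auto simp: eventually_conj_iff)
    then show "eventually (\<lambda>x. g x \<in> U) F" by eventually_elim (simp add: V)
  qed
qed

lemma topspace_mat_topology: "topspace (mat_topology n) = carrier_mat n n"
  by (auto simp: mat_topology_def topspace_pullback_topology)

lemma limitin_mat_topology:
  fixes f :: "'b \<Rightarrow> 'a::topological_space mat"
  shows "limitin (mat_topology n) f l F \<longleftrightarrow> l \<in> carrier_mat n n \<and> eventually (\<lambda>x. f x \<in> carrier_mat n n) F \<and>
    (\<forall>i<n. \<forall>j<n. ((\<lambda>x. f x $$ (i, j)) \<longlongrightarrow> l $$ (i, j)) F)"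
proof -
  let ?I = "{..<n} \<times> {..<n}"
  have "limitin (product_topology (\<lambda>_. euclidean) ?I) (\<lambda>x. restrict (\<lambda>ij. f x $$ ij) ?I) (restrict (\<lambda>ij. l $$ ij) ?I) F
    \<longleftrightarrow> (\<forall>i<n. \<forall>j<n. ((\<lambda>x. f x $$ (i, j)) \<longlongrightarrow> l $$ (i, j)) F)"
    by (auto simp: limitin_componentwise)
  moreover have "(\<lambda>A. restrict (\<lambda>ij. A $$ ij) ?I) ` (carrier_mat n n :: 'a mat set) \<subseteq> topspace (product_topology (\<lambda>_. euclidean) ?I)"
    by (rule image_subsetI) (simp add: restrict_PiE_iff)
  ultimately show ?thesis
    unfolding mat_topology_def by (simp only: limitin_pullback_topology)
qed

lemma topspace_ST_plus_topology: "topspace (ST_plus_topology n) = carrier (ST_plus n)"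
  by (auto simp: ST_plus_topology_def topspace_mat_topology ST_plus_def)

lemma limitin_ST_plus_topology:
  "limitin (ST_plus_topology n) f l F \<longleftrightarrow>
    l \<in> carrier (ST_plus n) \<and> eventually (\<lambda>x. f x \<in> carrier (ST_plus n)) F \<and>
    (\<forall>i<n. \<forall>j<n. ((\<lambda>x. f x $$ (i, j)) \<longlongrightarrow> l $$ (i, j)) F)"
proof -
  have "eventually (\<lambda>x. f x \<in> carrier (ST_plus n)) F \<Longrightarrow> eventually (\<lambda>x. f x \<in> carrier_mat n n) F"
    by (erule eventually_mono) (simp add: ST_plus_def)
  then show ?thesis
    by (auto simp: ST_plus_topology_def limitin_subtopology limitin_mat_topology) (auto simp: ST_plus_def)
qed

lemma limitin_self_atin: "a \<in> topspace X \<Longrightarrow> limitin X (\<lambda>x. x) a (atin X a)"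
  by (auto simp: limitin_atin)

text \<open>The Leibniz formula is a polynomial in the entries.\<close>

lemma tendsto_det:
  fixes f :: "'b \<Rightarrow> 'a::topological_field mat"
  assumes "\<And>x. f x \<in> carrier_mat n n" "l \<in> carrier_mat n n"
    "\<And>i j. i < n \<Longrightarrow> j < n \<Longrightarrow> ((\<lambda>x. f x $$ (i, j)) \<longlongrightarrow> l $$ (i, j)) F"
  shows "((\<lambda>x. det (f x)) \<longlongrightarrow> det l) F"
  unfolding det_def'[OF assms(1)] det_def'[OF assms(2)]
  by (intro tendsto_sum tendsto_mult tendsto_const tendsto_prod_field assms(3))
     (auto dest: permutes_in_image)

lemma hausdorff_group_topology_ST_plus:
  "hausdorff_group_topology (ST_plus n) (ST_plus_topology n :: 'a::{topological_field,t2_space} mat topology)"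
proof -
  let ?G = "ST_plus n :: 'a mat monoid" and ?T = "ST_plus_topology n :: 'a mat topology"
  have "continuous_map (prod_topology ?T ?T) ?T (\<lambda>(A, B). A * B)"
    unfolding continuous_map_atin
  proof
    fix P :: "'a mat \<times> 'a mat" assume P: "P \<in> topspace (prod_topology ?T ?T)"
    let ?F = "atin (prod_topology ?T ?T) P"
    have c: "fst P \<in> carrier ?G" "snd P \<in> carrier ?G"
      using P by (auto simp: topspace_ST_plus_topology)
    have "limitin ?T (\<lambda>Q. fst Q) (fst P) ?F \<and> limitin ?T (\<lambda>Q. snd Q) (snd P) ?F"
      using limitin_self_atin[OF P] by (simp add: limitin_pairwise comp_def)
    then have lim: "eventually (\<lambda>Q. fst Q \<in> carrier ?G) ?F" "eventually (\<lambda>Q. snd Q \<in> carrier ?G) ?F"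
        "\<And>i j. i < n \<Longrightarrow> j < n \<Longrightarrow> ((\<lambda>Q. fst Q $$ (i, j)) \<longlongrightarrow> fst P $$ (i, j)) ?F"
        "\<And>i j. i < n \<Longrightarrow> j < n \<Longrightarrow> ((\<lambda>Q. snd Q $$ (i, j)) \<longlongrightarrow> snd P $$ (i, j)) ?F"
      by (auto simp: limitin_ST_plus_topology)
    have sub: "A \<in> carrier ?G \<Longrightarrow> A \<in> carrier_mat n n" for A by (simp add: ST_plus_def)
    have "((\<lambda>Q. (fst Q * snd Q) $$ (i, j)) \<longlongrightarrow> (fst P * snd P) $$ (i, j)) ?F" if "i < n" "j < n" for i j
    proof -
      have "((\<lambda>Q. \<Sum>k<n. fst Q $$ (i, k) * snd Q $$ (k, j)) \<longlongrightarrow>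
          (\<Sum>k<n. fst P $$ (i, k) * snd P $$ (k, j))) ?F"
        using that by (intro tendsto_sum tendsto_mult lim) auto
      also have "(\<Sum>k<n. fst P $$ (i, k) * snd P $$ (k, j)) = (fst P * snd P) $$ (i, j)"
        by (rule index_mult_mat_sum[OF sub[OF c(1)] sub[OF c(2)] that, symmetric])
      finally show ?thesis
      proof (rule Lim_transform_eventually)
        show "eventually (\<lambda>Q. (\<Sum>k<n. fst Q $$ (i, k) * snd Q $$ (k, j)) = (fst Q * snd Q) $$ (i, j)) ?F"
          using lim(1,2) by eventually_elim (rule index_mult_mat_sum[OF sub sub that, symmetric])
      qed
    qed
    moreover have "eventually (\<lambda>Q. fst Q * snd Q \<in> carrier ?G) ?F"
      using lim(1,2) by eventually_elim (rule ST_plus_mult_closed)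
    ultimately show "limitin ?T (\<lambda>(A, B). A * B) (case P of (A, B) \<Rightarrow> A * B) ?F"
      using c by (simp add: case_prod_beta limitin_ST_plus_topology ST_plus_mult_closed)
  qed
  moreover have "continuous_map ?T ?T (\<lambda>A. inv\<^bsub>?G\<^esub> A)"
    unfolding continuous_map_atin
  proof
    fix A assume "A \<in> topspace ?T"
    then have A: "A \<in> carrier ?G" by (simp add: topspace_ST_plus_topology)
    let ?F = "atin ?T A"
    have lim: "eventually (\<lambda>B. B \<in> carrier ?G) ?F"
        "\<And>i j. i < n \<Longrightarrow> j < n \<Longrightarrow> ((\<lambda>B. B $$ (i, j)) \<longlongrightarrow> A $$ (i, j)) ?F"
      using limitin_self_atin[OF \<open>A \<in> topspace ?T\<close>] by (auto simp: limitin_ST_plus_topology)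
    have "((\<lambda>B. adj_mat B $$ (i, j)) \<longlongrightarrow> adj_mat A $$ (i, j)) ?F" if ij: "i < n" "j < n" for i j
    proof -
      \<comment> \<open>This is the minor \<open>mat_delete B j i\<close> with its size fixed in
        advance, because \<open>tendsto_det\<close> asks for the right dimensions at every
        \<open>B\<close>, also outside the group. The indices are swapped since the adjugate is the
        transpose of the cofactor matrix.\<close>
      define D where "D B = mat (n - 1) (n - 1) (\<lambda>(k, l). B $$ (if k < j then k else Suc k, if l < i then l else Suc l))"
        for B :: "'a mat"
      have eq: "(-1) ^ (j + i) * det (D B) = adj_mat B $$ (i, j)" if "B \<in> carrier ?G" for B
      proof -
        have dim: "dim_row B = n" "dim_col B = n" using that by (auto simp: ST_plus_def)
        then have "mat_delete B j i = D B" by (simp add: mat_delete_def D_def)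
        with dim ij show ?thesis by (simp add: adj_mat_def cofactor_def)
      qed
      have "((\<lambda>B. (-1) ^ (j + i) * det (D B)) \<longlongrightarrow> (-1) ^ (j + i) * det (D A)) ?F"
        by (intro tendsto_mult tendsto_const tendsto_det[where n = "n - 1"])
           (use ij in \<open>auto simp: D_def intro!: lim\<close>)
      also have "(-1) ^ (j + i) * det (D A) = adj_mat A $$ (i, j)" using eq A .
      finally show ?thesis
      proof (rule Lim_transform_eventually)
        show "eventually (\<lambda>B. (-1) ^ (j + i) * det (D B) = adj_mat B $$ (i, j)) ?F"
          using lim(1) by eventually_elim (rule eq)
      qed
    qed
    moreover have "eventually (\<lambda>B. adj_mat B \<in> carrier ?G) ?F"
      using lim(1) by eventually_elim (rule adj_mat_ST_plus)
    ultimately have "limitin ?T adj_mat (adj_mat A) ?F"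
      using A by (simp add: limitin_ST_plus_topology adj_mat_ST_plus)
    moreover have "eventually (\<lambda>B. adj_mat B = inv\<^bsub>?G\<^esub> B) ?F"
      using lim(1) by eventually_elim (simp add: inv_ST_plus)
    ultimately show "limitin ?T (\<lambda>B. inv\<^bsub>?G\<^esub> B) (inv\<^bsub>?G\<^esub> A) ?F"
      using A by (simp add: inv_ST_plus limitin_transform_eventually)
  qed
  moreover have "Hausdorff_space ?T"
    unfolding Hausdorff_space_def
  proof (intro allI impI)
    fix A B assume AB: "A \<in> topspace ?T \<and> B \<in> topspace ?T \<and> A \<noteq> B"
    then have c: "A \<in> carrier_mat n n" "B \<in> carrier_mat n n" by (auto simp: topspace_ST_plus_topology ST_plus_def)
    with AB obtain i j where ij: "i < n" "j < n" "A $$ (i, j) \<noteq> B $$ (i, j)" by (metis carrier_matD eq_matI)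
    then obtain U V where UV: "open U" "open V" "A $$ (i, j) \<in> U" "B $$ (i, j) \<in> V" "U \<inter> V = {}"
      using hausdorff by metis
    have cont: "continuous_map ?T euclidean (\<lambda>A. A $$ (i, j))"
      unfolding continuous_map_atin using limitin_self_atin[of _ ?T] ij
      by (auto simp: limitin_ST_plus_topology)
    let ?P = "\<lambda>W. {A \<in> topspace ?T. A $$ (i, j) \<in> W}"
    have "openin ?T (?P U)" "openin ?T (?P V)"
      using openin_continuous_map_preimage[OF cont] UV by auto
    moreover have "A \<in> ?P U" "B \<in> ?P V" "disjnt (?P U) (?P V)" using AB UV by (auto simp: disjnt_iff)
    ultimately show "\<exists>U V. openin ?T U \<and> openin ?T V \<and> A \<in> U \<and> B \<in> V \<and> disjnt U V" by blast
  qed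
  ultimately show ?thesis
    by (simp add: hausdorff_group_topology_def group_topology_def topspace_ST_plus_topology)
qed

section \<open>Coarser group topologies\<close>

lemma limitin_mono_filter: "limitin X f l F \<Longrightarrow> F' \<le> F \<Longrightarrow> limitin X f l F'"
  by (auto simp: limitin_def filter_leD)

lemma limitin_group_mult:
  assumes "group_topology G T" "limitin T f a F" "limitin T g b F"
  shows "limitin T (\<lambda>x. f x \<otimes>\<^bsub>G\<^esub> g x) (a \<otimes>\<^bsub>G\<^esub> b) F"
proof -
  have "limitin (prod_topology T T) (\<lambda>x. (f x, g x)) (a, b) F"
    using assms by (simp add: limitin_pairwise comp_def)
  from continuous_map_limit[OF _ this, of T "\<lambda>(x, y). x \<otimes>\<^bsub>G\<^esub> y"] assms(1)
  show ?thesis by (simp add: group_topology_def comp_def)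
qed

lemma limitin_group_inv:
  assumes "group_topology G T" "limitin T f a F"
  shows "limitin T (\<lambda>x. inv\<^bsub>G\<^esub> f x) (inv\<^bsub>G\<^esub> a) F"
  using continuous_map_limit[OF _ assms(2), of T "\<lambda>x. inv\<^bsub>G\<^esub> x"] assms(1)
  by (simp add: group_topology_def comp_def)

section \<open>The last-column subgroup, diagonal matrices and conjugation\<close>

definition col_mat :: "nat \<Rightarrow> (nat \<Rightarrow> 'a) \<Rightarrow> 'a::field mat" where
  "col_mat N v = mat (Suc N) (Suc N) (\<lambda>(i, j). if i = j then 1 else if j = N then v i else 0)"

definition dg_mat :: "nat \<Rightarrow> (nat \<Rightarrow> 'a) \<Rightarrow> 'a::field mat" where
  "dg_mat N d = mat (Suc N) (Suc N) (\<lambda>(i, j). if i = j then d i else 0)"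

lemma col_mat_carrier [simp]: "col_mat N v \<in> carrier (ST_plus (Suc N))"
  by (auto simp: ST_plus_iff col_mat_def)

lemma dg_mat_carrier: "(\<Prod>i<Suc N. d i) = 1 \<Longrightarrow> dg_mat N d \<in> carrier (ST_plus (Suc N))"
  by (auto simp: ST_plus_iff dg_mat_def)

lemma col_mat_index: "i < Suc N \<Longrightarrow> j < Suc N \<Longrightarrow>
  col_mat N v $$ (i, j) = (if i = j then 1 else if j = N then v i else 0)"
  by (simp add: col_mat_def)

lemma dg_mat_index: "i < Suc N \<Longrightarrow> j < Suc N \<Longrightarrow> dg_mat N d $$ (i, j) = (if i = j then d i else 0)"
  by (simp add: dg_mat_def)

lemma col_mat_cong: "(\<And>i. i < N \<Longrightarrow> v i = w i) \<Longrightarrow> col_mat N v = col_mat N w"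
  by (rule eq_matI) (auto simp: col_mat_def)

lemma col_mat_zero: "(\<And>i. i < N \<Longrightarrow> v i = 0) \<Longrightarrow> col_mat N v = 1\<^sub>m (Suc N)"
  by (rule eq_matI) (auto simp: col_mat_def)

lemma col_mat_mult_index:
  assumes "g \<in> carrier_mat (Suc N) (Suc N)" "i < Suc N" "j < Suc N"
  shows "(col_mat N w * g) $$ (i, j) = g $$ (i, j) + (if i < N then w i * g $$ (N, j) else 0)"
proof -
  have c: "col_mat N w \<in> carrier_mat (Suc N) (Suc N)" by (simp add: col_mat_def)
  have "(\<Sum>k<N. col_mat N w $$ (i, k) * g $$ (k, j)) = (\<Sum>k<N. if k = i then g $$ (i, j) else 0)"
    using assms by (intro sum.cong) (auto simp: col_mat_index)
  with assms show ?thesis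
    unfolding index_mult_mat_sum[OF c assms] by (auto simp: col_mat_index less_Suc_eq)
qed

lemma mult_col_mat_index:
  assumes "g \<in> carrier_mat (Suc N) (Suc N)" "i < Suc N" "j < Suc N"
  shows "(g * col_mat N v) $$ (i, j) = g $$ (i, j) + (if j = N then \<Sum>k<N. g $$ (i, k) * v k else 0)"
proof -
  have c: "col_mat N v \<in> carrier_mat (Suc N) (Suc N)" by (simp add: col_mat_def)
  have "(\<Sum>k<N. g $$ (i, k) * col_mat N v $$ (k, j)) =
      (if j = N then \<Sum>k<N. g $$ (i, k) * v k else (\<Sum>k<N. if k = j then g $$ (i, j) else 0))"
    using assms by (cases "j = N") (simp_all add: col_mat_index if_distrib[of "\<lambda>x. _ * x"] cong: if_cong)
  with assms show ?thesis
    unfolding index_mult_mat_sum[OF assms(1) c assms(2,3)] by (auto simp: col_mat_index less_Suc_eq)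
qed

lemma dg_mat_mult_index:
  assumes "g \<in> carrier_mat (Suc N) (Suc N)" "i < Suc N" "j < Suc N"
  shows "(dg_mat N d * g) $$ (i, j) = d i * g $$ (i, j)" "(g * dg_mat N d) $$ (i, j) = g $$ (i, j) * d j"
proof -
  have c: "dg_mat N d \<in> carrier_mat (Suc N) (Suc N)" by (simp add: dg_mat_def)
  have "(\<Sum>k<Suc N. dg_mat N d $$ (i, k) * g $$ (k, j)) = (\<Sum>k<Suc N. if k = i then d i * g $$ (i, j) else 0)"
    using assms by (intro sum.cong) (auto simp: dg_mat_index)
  then show "(dg_mat N d * g) $$ (i, j) = d i * g $$ (i, j)"
    unfolding index_mult_mat_sum[OF c assms] using assms by (simp del: sum.lessThan_Suc)
  have "(\<Sum>k<Suc N. g $$ (i, k) * dg_mat N d $$ (k, j)) = (\<Sum>k<Suc N. if k = j then g $$ (i, j) * d j else 0)"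
    using assms by (intro sum.cong) (auto simp: dg_mat_index)
  then show "(g * dg_mat N d) $$ (i, j) = g $$ (i, j) * d j"
    unfolding index_mult_mat_sum[OF assms(1) c assms(2,3)] using assms by (simp del: sum.lessThan_Suc)
qed

text \<open>Makes the last-column matrices a copy of the additive group of vectors of length
  \<open>N\<close>, so that group quotients become differences.\<close>

lemma col_mat_mult: "col_mat N v * col_mat N w = col_mat N (\<lambda>i. v i + w i)"
proof (rule eq_matI)
  have c: "col_mat N u \<in> carrier_mat (Suc N) (Suc N)" for u :: "nat \<Rightarrow> 'a" by (simp add: col_mat_def)
  fix i j assume "i < dim_row (col_mat N (\<lambda>i. v i + w i))" "j < dim_col (col_mat N (\<lambda>i. v i + w i))"
  then have ij: "i < Suc N" "j < Suc N" by (auto simp: col_mat_def)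
  show "(col_mat N v * col_mat N w) $$ (i, j) = col_mat N (\<lambda>i. v i + w i) $$ (i, j)"
    unfolding col_mat_mult_index[OF c ij] using ij by (auto simp: col_mat_index)
qed (auto simp: col_mat_def)

text \<open>The last-column subgroup is normal, and \<open>g\<close> acts on it by its upper left
  block divided by \<open>g $$ (N, N)\<close>. Checking
  \<open>g * col_mat N v = col_mat N w * g\<close> avoids computing the inverse; the last row of
  \<open>g\<close> vanishes left of the diagonal.\<close>

lemma conj_col_mat:
  assumes g: "g \<in> carrier (ST_plus (Suc N))"
    and w: "\<And>i. i < N \<Longrightarrow> w i = (\<Sum>k<N. g $$ (i, k) * v k) / g $$ (N, N)"
  shows "g * col_mat N v * adj_mat g = col_mat N w"
proof -
  have c: "g \<in> carrier_mat (Suc N) (Suc N)" using g by (simp add: ST_plus_def)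
  have cc: "col_mat N u \<in> carrier_mat (Suc N) (Suc N)" for u :: "nat \<Rightarrow> 'a" by (simp add: col_mat_def)
  have nz: "g $$ (N, N) \<noteq> 0" using ST_plus_diag_nz[OF g] by simp
  have z: "g $$ (N, j) = 0" if "j < N" for j using g that by (simp add: ST_plus_iff)
  have "g * col_mat N v = col_mat N w * g"
  proof (rule eq_matI)
    fix i j assume "i < dim_row (col_mat N w * g)" "j < dim_col (col_mat N w * g)"
    then have ij: "i < Suc N" "j < Suc N" using c by (auto simp: col_mat_def)
    show "(g * col_mat N v) $$ (i, j) = (col_mat N w * g) $$ (i, j)"
      unfolding col_mat_mult_index[OF c ij] mult_col_mat_index[OF c ij]
      using ij nz z w[of i] by (auto simp: less_Suc_eq)
  qed (use c in \<open>auto simp: col_mat_def\<close>)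
  moreover have "adj_mat g \<in> carrier_mat (Suc N) (Suc N)"
    using adj_mat_ST_plus(1)[OF g] by (simp add: ST_plus_def)
  ultimately have "g * col_mat N v * adj_mat g = col_mat N w * (g * adj_mat g)"
    using assoc_mult_mat[OF cc c] by simp
  then show ?thesis using adj_mat_ST_plus(2)[OF g] right_mult_one_mat[OF cc] by simp
qed

section \<open>A coarser Hausdorff group topology\<close>

locale coarser_ST_plus =
  fixes N :: nat and S :: "'a::local_field mat topology"
  assumes hausdorff_S: "hausdorff_group_topology (ST_plus (Suc N)) S"
    and coarser: "\<And>U. openin S U \<Longrightarrow> openin (ST_plus_topology (Suc N)) U"
    and two_nonzero: "(2::'a) \<noteq> 0"
begin

abbreviation "C \<equiv> carrier (ST_plus (Suc N)) :: 'a mat set"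
abbreviation "I \<equiv> 1\<^sub>m (Suc N) :: 'a mat"

lemma group_S: "group_topology (ST_plus (Suc N)) S" "Hausdorff_space S" "topspace S = C"
  using hausdorff_S by (auto simp: hausdorff_group_topology_def group_topology_def)

lemma one_C [simp]: "I \<in> C" by (simp add: ST_plus_def)

lemma C_dim: "g \<in> C \<Longrightarrow> g \<in> carrier_mat (Suc N) (Suc N)"
  by (simp add: ST_plus_def)

lemma limitin_coarser: "limitin (ST_plus_topology (Suc N)) f l F \<Longrightarrow> limitin S f l F"
  using coarser by (auto simp: limitin_def group_S topspace_ST_plus_topology)

lemma limitin_S_C: "limitin S f l F \<Longrightarrow> eventually (\<lambda>x. f x \<in> C) F"
  using limitinD[of S f l F C] openin_topspace[of S] limitin_topspace[of S f l F] by (simp add: group_S)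

lemma limitin_S_mult: "limitin S f a F \<Longrightarrow> limitin S g b F \<Longrightarrow> limitin S (\<lambda>x. f x * g x) (a * b) F"
  using limitin_group_mult[OF group_S(1)] by simp

lemma limitin_S_adj:
  assumes "limitin S f a F"
  shows "limitin S (\<lambda>x. adj_mat (f x)) (adj_mat a) F"
proof -
  have "a \<in> C" using limitin_topspace[OF assms] by (simp add: group_S)
  then have "limitin S (\<lambda>x. inv\<^bsub>ST_plus (Suc N)\<^esub> f x) (adj_mat a) F"
    using limitin_group_inv[OF group_S(1) assms] by (simp add: inv_ST_plus)
  moreover have "eventually (\<lambda>x. inv\<^bsub>ST_plus (Suc N)\<^esub> f x = adj_mat (f x)) F"
    using limitin_S_C[OF assms] by eventually_elim (rule inv_ST_plus)
  ultimately show ?thesis by (rule limitin_transform_eventually[rotated])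
qed

lemma limitin_S_conj:
  assumes "limitin S g a F" "limitin S f I F"
  shows "limitin S (\<lambda>x. g x * f x * adj_mat (g x)) I F"
proof -
  have a: "a \<in> C" using limitin_topspace[OF assms(1)] by (simp add: group_S)
  have "a * I * adj_mat a = I" using adj_mat_ST_plus[OF a] C_dim[OF a] by simp
  with limitin_S_mult[OF limitin_S_mult[OF assms] limitin_S_adj[OF assms(1)]] show ?thesis by simp
qed

lemma limitin_S_const: "a \<in> C \<Longrightarrow> limitin S (\<lambda>x. a) a F"
  by (simp add: group_S)

lemma limitin_S_col_mat:
  assumes "\<And>i. i < N \<Longrightarrow> ((\<lambda>x. v x i) \<longlongrightarrow> l i) F"
  shows "limitin S (\<lambda>x. col_mat N (v x)) (col_mat N l) F"
  by (rule limitin_coarser)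
     (auto simp: limitin_ST_plus_topology col_mat_index intro!: assms)

section \<open>The corner subgroup\<close>

abbreviation "corner x \<equiv> col_mat N (\<lambda>i. if i = 0 then x else 0) :: 'a mat"

lemma corner_mult: "corner x * corner y = corner (x + y)"
  unfolding col_mat_mult by (rule col_mat_cong) auto

text \<open>The conjugators \<open>diag(t, 1, ..., 1, 1/t)\<close> tend to \<open>I\<close>
  entrywise, hence in \<open>S\<close>, so conjugation by them preserves convergence to
  \<open>I\<close>. For \<open>N = 0\<close> the corner would fall on the diagonal, whence
  \<open>N > 0\<close>.\<close>

lemma corner_scale:
  assumes N: "N > 0" and t: "(t \<longlongrightarrow> 1) F" and x: "limitin S (\<lambda>b. corner (x b)) I F"
  shows "limitin S (\<lambda>b. corner (t b ^ 2 * x b)) I F"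
proof -
  define d :: "'a \<Rightarrow> nat \<Rightarrow> 'a" where "d s i = (if i = 0 then s else if i = N then inverse s else 1)" for s i
  have prod1: "(\<Prod>i<Suc N. d s i) = 1" if "s \<noteq> 0" for s
  proof -
    have "(\<Prod>i<Suc N. d s i) = (\<Prod>i\<in>{0, N}. d s i)"
      by (rule prod.mono_neutral_right) (auto simp: d_def)
    with N that show ?thesis by (simp add: d_def)
  qed
  have nz: "eventually (\<lambda>b. t b \<noteq> 0) F"
    using topological_tendstoD[OF t, of "- {0}"] by auto
  have "limitin S (\<lambda>b. dg_mat N (d (t b))) I F"
  proof (rule limitin_coarser, unfold limitin_ST_plus_topology, intro conjI allI impI)
    show "eventually (\<lambda>b. dg_mat N (d (t b)) \<in> C) F"
      using nz by eventually_elim (intro dg_mat_carrier prod1)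
    fix i j assume ij: "i < Suc N" "j < Suc N"
    have "((\<lambda>b. d (t b) i) \<longlongrightarrow> 1) F"
      using t tendsto_inverse_field[OF t] by (cases "i = 0"; cases "i = N") (simp_all add: d_def)
    then show "((\<lambda>b. dg_mat N (d (t b)) $$ (i, j)) \<longlongrightarrow> I $$ (i, j)) F"
      using ij by (cases "i = j") (simp_all add: dg_mat_index)
  qed simp
  then have "limitin S (\<lambda>b. dg_mat N (d (t b)) * corner (x b) * adj_mat (dg_mat N (d (t b)))) I F"
    using x by (rule limitin_S_conj)
  moreover have "eventually (\<lambda>b. dg_mat N (d (t b)) * corner (x b) * adj_mat (dg_mat N (d (t b)))
      = corner (t b ^ 2 * x b)) F"
    using nz
  proof eventually_elim
    case (elim b)
    show ?case
    proof (rule conj_col_mat)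
      show "dg_mat N (d (t b)) \<in> C" by (intro dg_mat_carrier prod1 elim)
      fix i assume i: "i < N"
      have "(\<Sum>k<N. dg_mat N (d (t b)) $$ (i, k) * (if k = 0 then x b else 0)) =
          (\<Sum>k<N. if k = 0 then dg_mat N (d (t b)) $$ (i, 0) * x b else 0)"
        by (intro sum.cong) auto
      with i N elim show "(if i = 0 then t b ^ 2 * x b else 0) =
        (\<Sum>k<N. dg_mat N (d (t b)) $$ (i, k) * (if k = 0 then x b else 0)) / dg_mat N (d (t b)) $$ (N, N)"
        by (simp add: dg_mat_index d_def power2_eq_square field_simps)
    qed
  qed
  ultimately show ?thesis by (rule limitin_transform_eventually[rotated])
qed

lemma adj_col_mat: "adj_mat (col_mat N v) = col_mat N (\<lambda>i. - v i :: 'a)"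
proof -
  have "col_mat N (\<lambda>i. - v i) * col_mat N v = I"
    unfolding col_mat_mult by (rule col_mat_zero) simp
  then have "inv\<^bsub>ST_plus (Suc N)\<^esub> (col_mat N v) = col_mat N (\<lambda>i. - v i)"
    by (intro group.inv_equality[OF group_ST_plus]) auto
  then show ?thesis by (simp add: inv_ST_plus)
qed

lemma adj_corner: "adj_mat (corner x) = corner (- x)"
  unfolding adj_col_mat by (rule col_mat_cong) simp

text \<open>
  The substitute for multiplication by scalars near \<open>0\<close>, which are not available as
  conjugations: \<open>(1 + a)\<^sup>2 - (1 - a)\<^sup>2 = 4 a\<close>. This is the only place where
  characteristic \<open>2\<close> matters.
\<close>

lemma corner_small_scale:
  assumes N: "N > 0" and a: "(a \<longlongrightarrow> 0) F" and x: "limitin S (\<lambda>b. corner (x b)) I F"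
  shows "limitin S (\<lambda>b. corner (4 * a b * x b)) I F"
proof -
  have "((\<lambda>b. 1 + a b) \<longlongrightarrow> 1 + 0) F" "((\<lambda>b. 1 - a b) \<longlongrightarrow> 1 - 0) F"
    using a by (intro tendsto_intros | assumption)+
  then have "limitin S (\<lambda>b. corner ((1 + a b)^2 * x b)) I F" "limitin S (\<lambda>b. corner ((1 - a b)^2 * x b)) I F"
    using corner_scale[OF N _ x] by auto
  then have "limitin S (\<lambda>b. corner ((1 + a b)^2 * x b) * adj_mat (corner ((1 - a b)^2 * x b))) (I * adj_mat I) F"
    by (intro limitin_S_mult limitin_S_adj)
  moreover have "I * adj_mat I = I" using adj_mat_ST_plus[OF one_C] by simp
  moreover have "(1 + a b)^2 * x b + - ((1 - a b)^2 * x b) = 4 * a b * x b" for b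
    by (simp add: power2_eq_square algebra_simps)
  ultimately show ?thesis
    by (simp only: adj_corner corner_mult)
qed

lemma corner_tendsto_0:
  assumes N: "N > 0" and x: "limitin S (\<lambda>b. corner (x b)) I F"
  shows "(x \<longlongrightarrow> 0) F"
proof (rule local_field_tendstoI)
  have corner_eq_I: "y = 0" if "corner y = I" for y
  proof -
    have "corner y $$ (0, N) = I $$ (0, N)" using that by simp
    then show ?thesis using N by (simp add: col_mat_index)
  qed
  fix G assume G: "G \<le> F" "G \<noteq> bot"
  have xG: "limitin S (\<lambda>b. corner (x b)) I G" using x G(1) by (rule limitin_mono_filter)
  {
    fix z assume z: "(x \<longlongrightarrow> z) G"
    have "limitin S (\<lambda>b. corner (x b)) (corner z) G"
      using z by (intro limitin_S_col_mat) auto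
    then have "corner z = I" using xG G(2) group_S(2) by (rule limitin_Hausdorff_unique)
    then show "z = 0" by (rule corner_eq_I)
  next
    assume nz: "eventually (\<lambda>b. x b \<noteq> 0) G" and lim: "((\<lambda>b. inverse (x b)) \<longlongrightarrow> 0) G"
    \<comment> \<open>If \<open>x\<close> escapes to infinity, \<open>inverse (x b)\<close> is an
      admissible small scalar. The scaled corners are then eventually the constant
      \<open>corner 4\<close>, which differs from \<open>I\<close> because
      \<open>2 \<noteq> 0\<close>.\<close>
    have "limitin S (\<lambda>b. corner (4 * inverse (x b) * x b)) I G"
      by (rule corner_small_scale[OF N lim xG])
    moreover have "eventually (\<lambda>b. corner (4 * inverse (x b) * x b) = corner 4) G"
      using nz
    proof eventually_elim
      case (elim b)
      then have "4 * inverse (x b) * x b = 4" by (simp add: mult.assoc)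
      then show ?case by (simp only:)
    qed
    ultimately have "limitin S (\<lambda>b. corner 4) I G" by (rule limitin_transform_eventually[rotated])
    moreover have "limitin S (\<lambda>b. corner 4) (corner 4) G" by (rule limitin_S_const) simp
    ultimately have "I = corner 4" using G(2) group_S(2) by (rule limitin_Hausdorff_unique)
    then have "(4::'a) = 0" by (intro corner_eq_I) (rule sym)
    moreover have "(2::'a) * 2 = 4" by simp
    ultimately show False using no_zero_divisors[OF two_nonzero two_nonzero] by metis
  }
qed

section \<open>Convergence in the last-column subgroup\<close>

lemma adj_I: "adj_mat I = I"
  using adj_mat_ST_plus[OF one_C] C_dim by (metis left_mult_one_mat)

text \<open>Reduces convergence to an arbitrary last-column matrix to convergence to
  \<open>I\<close>, the case treated by \<open>col_mat_tendsto_0\<close>.\<close>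

lemma limitin_S_diff:
  assumes "limitin S (\<lambda>b. col_mat N (v b)) (col_mat N a) F" "limitin S (\<lambda>b. col_mat N (w b)) (col_mat N a) F"
  shows "limitin S (\<lambda>b. col_mat N (\<lambda>i. v b i - w b i)) I F"
proof -
  have "col_mat N (\<lambda>i. a i - a i) = I" by (rule col_mat_zero) simp
  with limitin_S_mult[OF assms(1) limitin_S_adj[OF assms(2)]] show ?thesis
    by (simp add: adj_col_mat col_mat_mult)
qed

lemma col_mat_tendsto_0:
  assumes v: "limitin S (\<lambda>b. col_mat N (v b)) I F" and j: "j < N"
  shows "((\<lambda>b. v b j) \<longlongrightarrow> 0) F"
proof -
  have I0: "I = col_mat N (\<lambda>i. 0)" by (rule col_mat_zero[symmetric]) simp
  have pos: "((\<lambda>b. v b j) \<longlongrightarrow> 0) F" if j: "0 < j" "j < N" for j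
  proof (rule corner_tendsto_0)
    \<comment> \<open>Conjugation by this elementary matrix adds coordinate \<open>j\<close> to
      coordinate \<open>0\<close>; subtracting the original vector moves \<open>v b j\<close> alone
      into the corner.\<close>
    define E :: "'a mat" where
      "E = mat (Suc N) (Suc N) (\<lambda>(i, k). if i = k \<or> (i = 0 \<and> k = j) then 1 else 0)"
    have E: "E \<in> C" using j by (auto simp: ST_plus_iff E_def)
    have idx: "E $$ (i, k) = (if i = k \<or> (i = 0 \<and> k = j) then 1 else 0)" if "i < Suc N" "k < Suc N" for i k
      using that by (simp add: E_def)
    have "limitin S (\<lambda>b. E * col_mat N (v b) * adj_mat E) I F"
      by (rule limitin_S_conj[OF limitin_S_const[OF E] v])
    moreover have "E * col_mat N u * adj_mat E = col_mat N (\<lambda>i. u i + (if i = 0 then u j else 0))" for u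
    proof (rule conj_col_mat[OF E])
      fix i assume i: "i < N"
      have "(\<Sum>k<N. E $$ (i, k) * u k) =
          (\<Sum>k<N. (if k = i then u i else 0) + (if k = j then if i = 0 then u j else 0 else 0))"
        using i j by (intro sum.cong) (auto simp: idx)
      also have "\<dots> = u i + (if i = 0 then u j else 0)"
        using i j by (simp add: sum.distrib)
      finally show "u i + (if i = 0 then u j else 0) = (\<Sum>k<N. E $$ (i, k) * u k) / E $$ (N, N)"
        by (simp add: idx)
    qed
    ultimately have "limitin S (\<lambda>b. col_mat N (\<lambda>i. v b i + (if i = 0 then v b j else 0))) I F" by simp
    from limitin_S_diff[OF this[unfolded I0] v[unfolded I0]]
    show "limitin S (\<lambda>b. corner (v b j)) I F" by simp
    show "N > 0" using j by simp
  qed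
  \<comment> \<open>The other coordinates already tend to \<open>0\<close> in the field, so they can
    be subtracted, leaving a corner matrix.\<close>
  have "((\<lambda>b. v b 0) \<longlongrightarrow> 0) F"
  proof (rule corner_tendsto_0)
    have "limitin S (\<lambda>b. col_mat N (\<lambda>i. if i = 0 then 0 else v b i)) (col_mat N (\<lambda>i. 0)) F"
    proof (rule limitin_S_col_mat)
      show "((\<lambda>b. if i = 0 then 0 else v b i) \<longlongrightarrow> 0) F" if "i < N" for i
        using pos[of i] that by (cases "i = 0") auto
    qed
    from limitin_S_diff[OF v[unfolded I0] this]
    have "limitin S (\<lambda>b. col_mat N (\<lambda>i. v b i - (if i = 0 then 0 else v b i))) I F" .
    also have "(\<lambda>b. col_mat N (\<lambda>i. v b i - (if i = 0 then 0 else v b i))) = (\<lambda>b. corner (v b 0))"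
      by (intro ext col_mat_cong) auto
    finally show "limitin S (\<lambda>b. corner (v b 0)) I F" .
    show "N > 0" using j by simp
  qed
  with pos j show ?thesis by (cases "j = 0") auto
qed

section \<open>Entries of a convergent family up to a common scalar\<close>

text \<open>
  Conjugation only sees \<open>g\<close> modulo the center, so it yields the entries of \<open>g\<close> up to a
  common scalar; the scalar is recovered in \<open>last_diag_tendsto\<close> from the determinant.
\<close>

lemma ratio_tendsto_lt:
  assumes g: "limitin S g I F" and ij: "i < N" "j < N"
  shows "((\<lambda>b. g b $$ (i, j) / g b $$ (N, N)) \<longlongrightarrow> I $$ (i, j)) F"
proof -
  \<comment> \<open>Conjugating the \<open>j\<close>-th standard basis vector reads off the
    \<open>j\<close>-th column of \<open>g b\<close> above the last row, divided by
    \<open>g b $$ (N, N)\<close>.\<close>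
  define e where "e k = (if k = j then 1 else 0 :: 'a)" for k
  define w where "w b k = g b $$ (k, j) / g b $$ (N, N)" for b k
  have eq: "I * col_mat N e * adj_mat I = col_mat N e"
    using left_mult_one_mat[OF C_dim] right_mult_one_mat[OF C_dim] by (simp add: adj_I)
  have "limitin S (\<lambda>b. g b * col_mat N e * adj_mat (g b)) (I * col_mat N e * adj_mat I) F"
    using g by (intro limitin_S_mult limitin_S_adj limitin_S_const col_mat_carrier)
  then have "limitin S (\<lambda>b. g b * col_mat N e * adj_mat (g b)) (col_mat N e) F"
    unfolding eq .
  moreover have "eventually (\<lambda>b. g b * col_mat N e * adj_mat (g b) = col_mat N (w b)) F"
    using limitin_S_C[OF g]
  proof eventually_elim
    case (elim b)
    have "(\<Sum>k<N. g b $$ (i, k) * e k) = (\<Sum>k<N. if k = j then g b $$ (i, j) else 0)" for i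
      by (intro sum.cong) (auto simp: e_def)
    with ij show ?case by (intro conj_col_mat elim) (simp add: w_def)
  qed
  ultimately have "limitin S (\<lambda>b. col_mat N (w b)) (col_mat N e) F"
    by (rule limitin_transform_eventually[rotated])
  moreover have "limitin S (\<lambda>b. col_mat N e) (col_mat N e) F"
    by (intro limitin_S_const col_mat_carrier)
  ultimately have "limitin S (\<lambda>b. col_mat N (\<lambda>i. w b i - e i)) I F"
    by (rule limitin_S_diff)
  from col_mat_tendsto_0[OF this ij(1)] have "((\<lambda>b. w b i - e i) \<longlongrightarrow> 0) F" .
  from tendsto_add[OF this tendsto_const[of "e i"]] show ?thesis
    using ij by (simp add: w_def e_def)
qed

text \<open>As \<open>s\<close> tends to \<open>0\<close> its power tends to \<open>0\<close>, away
  from \<open>1\<close>, and nondiscreteness supplies nonzero \<open>s\<close> near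
  \<open>0\<close>. The diagonal matrix of \<open>ratio_tendsto_last\<close> needs such an
  \<open>s\<close>.\<close>

lemma exists_power_ne_1: "\<exists>s::'a. s \<noteq> 0 \<and> s ^ Suc N \<noteq> 1"
proof -
  have "((\<lambda>s::'a. s ^ Suc N) \<longlongrightarrow> 0 ^ Suc N) (at 0)"
    by (intro tendsto_power_field tendsto_ident_at)
  then have "eventually (\<lambda>s::'a. s ^ Suc N \<in> - {1}) (at 0)"
    by (rule topological_tendstoD) auto
  moreover have "eventually (\<lambda>s::'a. s \<noteq> 0) (at 0)" by (simp add: eventually_at_filter)
  ultimately have "eventually (\<lambda>s::'a. s \<noteq> 0 \<and> s ^ Suc N \<noteq> 1) (at 0)" by eventually_elim auto
  then show ?thesis using at_local_field_ne_bot eventually_happens by blast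
qed

lemma ratio_tendsto_last:
  assumes g: "limitin S g I F" and i: "i < N"
  shows "((\<lambda>b. g b $$ (i, N) / g b $$ (N, N)) \<longlongrightarrow> 0) F"
proof -
  obtain s :: 'a where s: "s \<noteq> 0" "s ^ Suc N \<noteq> 1" using exists_power_ne_1 by blast
  \<comment> \<open>\<open>D\<close> commutes with the block-diagonal part of \<open>g b\<close>, so the commutator isolates the last column\<close>
  define d where "d i = (if i < N then s else inverse (s ^ N))" for i
  define D where "D = dg_mat N d"
  have D: "D \<in> C" unfolding D_def by (rule dg_mat_carrier) (use s in \<open>simp add: d_def\<close>)
  \<comment> \<open>Found by comparing entries \<open>(i, N)\<close> in
    \<open>D * g b = col_mat N (w b) * (g b * D)\<close>; the factor is nonzero by the choice of
    \<open>s\<close> and can be divided out at the end.\<close>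
  define w where "w b i = (s ^ Suc N - 1) * (g b $$ (i, N) / g b $$ (N, N))" for b i
  have eq: "D * I * adj_mat (I * D) = I"
    using C_dim[OF D] adj_mat_ST_plus[OF D] by simp
  \<comment> \<open>The commutator is written as the quotient of \<open>D * g b\<close> by
    \<open>g b * D\<close>, both of which tend to \<open>D\<close> in \<open>S\<close>.\<close>
  have "limitin S (\<lambda>b. D * g b * adj_mat (g b * D)) (D * I * adj_mat (I * D)) F"
    using g D by (intro limitin_S_mult limitin_S_adj limitin_S_const)
  then have "limitin S (\<lambda>b. D * g b * adj_mat (g b * D)) I F"
    unfolding eq .
  moreover have "eventually (\<lambda>b. D * g b * adj_mat (g b * D) = col_mat N (w b)) F"
    using limitin_S_C[OF g]
  proof eventually_elim
    case (elim b)
    have c: "g b \<in> carrier_mat (Suc N) (Suc N)" "D \<in> carrier_mat (Suc N) (Suc N)"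
      using elim D C_dim by auto
    then have gD: "g b * D \<in> carrier_mat (Suc N) (Suc N)" by simp
    have gD': "g b * D \<in> C" using elim D by (rule ST_plus_mult_closed)
    have cw: "col_mat N (w b) \<in> carrier_mat (Suc N) (Suc N)" using C_dim by simp
    have nz: "g b $$ (N, N) \<noteq> 0" using ST_plus_diag_nz[OF elim] by simp
    have z: "g b $$ (N, j) = 0" if "j < N" for j using elim that by (simp add: ST_plus_iff)
    have "D * g b = col_mat N (w b) * (g b * D)"
    proof (rule eq_matI)
      fix i j assume "i < dim_row (col_mat N (w b) * (g b * D))" "j < dim_col (col_mat N (w b) * (g b * D))"
      then have ij: "i < Suc N" "j < Suc N" using gD cw c by auto
      have "(col_mat N (w b) * (g b * D)) $$ (i, j) =
          g b $$ (i, j) * d j + (if i < N then w b i * (g b $$ (N, j) * d j) else 0)"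
        unfolding col_mat_mult_index[OF gD ij] using ij
        by (simp add: D_def dg_mat_mult_index(2)[OF c(1)] del: index_mult_mat)
      also have "\<dots> = d i * g b $$ (i, j)"
      proof (cases "j = N")
        case True
        have "s ^ Suc N * inverse (s ^ N) = s" using s by simp
        then show ?thesis using True ij s nz
          by (cases "i = N") (auto simp: w_def d_def field_simps)
      next
        case False
        then have "j < N" using ij by simp
        then show ?thesis using ij z by (cases "i = N") (auto simp: d_def)
      qed
      finally show "(D * g b) $$ (i, j) = (col_mat N (w b) * (g b * D)) $$ (i, j)"
        unfolding D_def dg_mat_mult_index(1)[OF c(1) ij] by simp
    qed (use gD cw c in auto)
    then have "D * g b * adj_mat (g b * D) = col_mat N (w b) * ((g b * D) * adj_mat (g b * D))"
      using assoc_mult_mat[OF cw gD C_dim[OF adj_mat_ST_plus(1)[OF gD']]] by simp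
    then show ?case using adj_mat_ST_plus(2)[OF gD'] right_mult_one_mat[OF cw] by simp
  qed
  ultimately have "limitin S (\<lambda>b. col_mat N (w b)) I F"
    by (rule limitin_transform_eventually[rotated])
  from col_mat_tendsto_0[OF this i]
  have "((\<lambda>b. w b i / (s ^ Suc N - 1)) \<longlongrightarrow> 0 / (s ^ Suc N - 1)) F"
    using s by (intro tendsto_divide_field tendsto_const) auto
  then show ?thesis using s(2) by (simp add: w_def)
qed

lemma ratio_tendsto:
  assumes g: "limitin S g I F" and ij: "i < Suc N" "j < Suc N"
  shows "((\<lambda>b. g b $$ (i, j) / g b $$ (N, N)) \<longlongrightarrow> I $$ (i, j)) F"
proof -
  consider "i < N" "j < N" | "i < N" "j = N" | "i = N" "j < N" | "i = N" "j = N" using ij by linarith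
  then show ?thesis
  proof cases
    case 1 then show ?thesis using ratio_tendsto_lt[OF g] by blast
  next
    case 2 then show ?thesis using ratio_tendsto_last[OF g] by simp
  next
    case 3
    have "eventually (\<lambda>b. g b $$ (i, j) / g b $$ (N, N) = I $$ (i, j)) F"
      using limitin_S_C[OF g] by eventually_elim (use 3 in \<open>simp add: ST_plus_iff\<close>)
    then show ?thesis by (rule tendsto_eventually)
  next
    case 4
    have "eventually (\<lambda>b. g b $$ (i, j) / g b $$ (N, N) = I $$ (i, j)) F"
      using limitin_S_C[OF g] by eventually_elim (use 4 ST_plus_diag_nz[of _ "Suc N" N] in auto)
    then show ?thesis by (rule tendsto_eventually)
  qed
qed

text \<open>The product of the diagonal ratios is \<open>inverse (g b $$ (N, N)) ^ Suc N\<close>, as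
  the determinant is \<open>1\<close>. This excludes infinity but leaves a root of unity
  undetermined; the Hausdorff property of \<open>S\<close> removes that ambiguity.\<close>

lemma last_diag_tendsto:
  assumes g: "limitin S g I F"
  shows "((\<lambda>b. g b $$ (N, N)) \<longlongrightarrow> 1) F"
proof (rule local_field_tendstoI)
  let ?x = "\<lambda>b. g b $$ (N, N)"
  have "((\<lambda>b. \<Prod>i<Suc N. g b $$ (i, i) / ?x b) \<longlongrightarrow> (\<Prod>i<Suc N. I $$ (i, i))) F"
    by (intro tendsto_prod_field ratio_tendsto[OF g]) auto
  moreover have "eventually (\<lambda>b. (\<Prod>i<Suc N. g b $$ (i, i) / ?x b) = inverse (?x b) ^ Suc N) F"
    using limitin_S_C[OF g]
  proof eventually_elim
    case (elim b)
    have "(\<Prod>i<Suc N. g b $$ (i, i) / ?x b) = (\<Prod>i<Suc N. g b $$ (i, i)) / ?x b ^ Suc N"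
      unfolding prod_dividef by simp
    moreover have "(\<Prod>i<Suc N. g b $$ (i, i)) = 1" using elim by (simp only: ST_plus_iff)
    ultimately show ?case by (simp only: power_one_over inverse_eq_divide)
  qed
  ultimately have pow: "((\<lambda>b. inverse (?x b) ^ Suc N) \<longlongrightarrow> 1) F"
    using Lim_transform_eventually by fastforce
  fix G assume G: "G \<le> F" "G \<noteq> bot"
  have powG: "((\<lambda>b. inverse (?x b) ^ Suc N) \<longlongrightarrow> 1) G"
    using pow G(1) by (rule filterlim_mono_domain)
  have CG: "eventually (\<lambda>b. g b \<in> C) G" using limitin_S_C[OF g] G(1) by (simp add: filter_leD)
  {
    fix z assume z: "(?x \<longlongrightarrow> z) G"
    have "((\<lambda>b. ?x b ^ Suc N * inverse (?x b) ^ Suc N) \<longlongrightarrow> z ^ Suc N * 1) G"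
      by (intro tendsto_mult tendsto_power_field z powG)
    moreover have "eventually (\<lambda>b. ?x b ^ Suc N * inverse (?x b) ^ Suc N = 1) G"
      using CG
    proof eventually_elim
      case (elim b)
      have "?x b \<noteq> 0" using ST_plus_diag_nz[OF elim] by simp
      then show ?case by (simp only: power_mult_distrib[symmetric]) simp
    qed
    ultimately have "((\<lambda>b. 1) \<longlongrightarrow> z ^ Suc N * 1) G" by (rule Lim_transform_eventually)
    then have z1: "z ^ Suc N = 1" using tendsto_unique[OF G(2) _ tendsto_const] by fastforce
    \<comment> \<open>All ratios converge to the entries of \<open>I\<close>, so along
      \<open>G\<close> the matrices converge entrywise to the scalar matrix \<open>Z\<close>.
      \<open>z1\<close> gives it determinant \<open>1\<close>, and uniqueness of limits in
      \<open>S\<close> forces \<open>Z = I\<close>.\<close>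
    define Z where "Z = dg_mat N (\<lambda>i. z)"
    have "limitin (ST_plus_topology (Suc N)) g Z G"
      unfolding limitin_ST_plus_topology
    proof (intro conjI allI impI CG)
      show "Z \<in> C" unfolding Z_def by (rule dg_mat_carrier) (use z1 in simp)
      fix i j assume ij: "i < Suc N" "j < Suc N"
      have "((\<lambda>b. ?x b * (g b $$ (i, j) / ?x b)) \<longlongrightarrow> z * I $$ (i, j)) G"
        by (intro tendsto_mult z filterlim_mono_domain[OF ratio_tendsto[OF g ij] G(1)])
      moreover have "eventually (\<lambda>b. ?x b * (g b $$ (i, j) / ?x b) = g b $$ (i, j)) G"
        using CG
      proof eventually_elim
        case (elim b)
        have "?x b \<noteq> 0" using ST_plus_diag_nz[OF elim] by simp
        then show ?case by simp
      qed
      moreover have "z * I $$ (i, j) = Z $$ (i, j)" using ij by (simp add: Z_def dg_mat_index)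
      ultimately show "((\<lambda>b. g b $$ (i, j)) \<longlongrightarrow> Z $$ (i, j)) G"
        using Lim_transform_eventually by fastforce
    qed
    then have "limitin S g Z G" by (rule limitin_coarser)
    moreover have "limitin S g I G" using g G(1) by (rule limitin_mono_filter)
    ultimately have "Z = I" using G(2) group_S(2) by (rule limitin_Hausdorff_unique)
    then have "Z $$ (N, N) = I $$ (N, N)" by simp
    then show "z = 1" by (simp add: Z_def dg_mat_index)
  next
    assume "((\<lambda>b. inverse (?x b)) \<longlongrightarrow> 0) G"
    then have "((\<lambda>b. inverse (?x b) ^ Suc N) \<longlongrightarrow> 0 ^ Suc N) G" by (rule tendsto_power_field)
    then show False using tendsto_unique[OF G(2) _ powG] by fastforce
  }
qed

section \<open>Equality of the two topologies\<close>

lemma limitin_finer: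
  assumes g: "limitin S g I F"
  shows "limitin (ST_plus_topology (Suc N)) g I F"
  unfolding limitin_ST_plus_topology
proof (intro conjI allI impI one_C limitin_S_C[OF g])
  fix i j assume ij: "i < Suc N" "j < Suc N"
  have "((\<lambda>b. g b $$ (N, N) * (g b $$ (i, j) / g b $$ (N, N))) \<longlongrightarrow> 1 * I $$ (i, j)) F"
    by (intro tendsto_mult last_diag_tendsto[OF g] ratio_tendsto[OF g ij])
  moreover have "eventually (\<lambda>b. g b $$ (N, N) * (g b $$ (i, j) / g b $$ (N, N)) = g b $$ (i, j)) F"
    using limitin_S_C[OF g]
  proof eventually_elim
    case (elim b)
    have "g b $$ (N, N) \<noteq> 0" using ST_plus_diag_nz[OF elim] by simp
    then show ?case by simp
  qed
  ultimately show "((\<lambda>b. g b $$ (i, j)) \<longlongrightarrow> I $$ (i, j)) F"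
    using Lim_transform_eventually by fastforce
qed

text \<open>Left translation carries \<open>limitin_finer\<close> from \<open>I\<close> to any point
  \<open>A\<close>: \<open>adj_mat A * B\<close> tends to \<open>I\<close> as \<open>B\<close> tends
  to \<open>A\<close> in \<open>S\<close>, and multiplying by \<open>A\<close> recovers
  \<open>B\<close>.\<close>

lemma openin_finer:
  assumes "openin (ST_plus_topology (Suc N)) U"
  shows "openin S U"
proof -
  let ?T = "ST_plus_topology (Suc N) :: 'a mat topology"
  have T: "group_topology (ST_plus (Suc N)) ?T"
    using hausdorff_group_topology_ST_plus by (auto simp: hausdorff_group_topology_def)
  have "continuous_map S ?T (\<lambda>A. A)"
    unfolding continuous_map_atin
  proof
    fix A assume "A \<in> topspace S"
    then have A: "A \<in> C" and id: "limitin S (\<lambda>B. B) A (atin S A)"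
      using limitin_self_atin[of A S] by (auto simp: group_S)
    have cA: "A \<in> carrier_mat (Suc N) (Suc N)" "adj_mat A \<in> carrier_mat (Suc N) (Suc N)"
      using C_dim A adj_mat_ST_plus(1) by auto
    have "limitin S (\<lambda>B. adj_mat A * B) I (atin S A)"
      using limitin_S_mult[OF limitin_S_const[OF adj_mat_ST_plus(1)[OF A]] id] adj_mat_ST_plus(3)[OF A] by simp
    then have "limitin ?T (\<lambda>B. adj_mat A * B) I (atin S A)" by (rule limitin_finer)
    moreover have "limitin ?T (\<lambda>B. A) A (atin S A)" using A by (simp add: topspace_ST_plus_topology)
    ultimately have "limitin ?T (\<lambda>B. A * (adj_mat A * B)) A (atin S A)"
      using limitin_group_mult[OF T, of "\<lambda>B. A" A "atin S A" "\<lambda>B. adj_mat A * B" I] cA by simp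
    moreover have "eventually (\<lambda>B. A * (adj_mat A * B) = B) (atin S A)"
      using limitin_S_C[OF id]
    proof eventually_elim
      case (elim B)
      have "A * (adj_mat A * B) = A * adj_mat A * B"
        using assoc_mult_mat[OF cA C_dim[OF elim]] by simp
      then show ?case using adj_mat_ST_plus(2)[OF A] C_dim[OF elim] by simp
    qed
    ultimately show "limitin ?T (\<lambda>B. B) A (atin S A)"
      by (rule limitin_transform_eventually[rotated])
  qed
  then have "openin S {A \<in> topspace S. A \<in> U}" using assms by (rule openin_continuous_map_preimage)
  moreover have "{A \<in> topspace S. A \<in> U} = U"
    using openin_subset[OF assms] by (auto simp: group_S topspace_ST_plus_topology)
  ultimately show ?thesis by simp
qed

end

theorem theorem3p19:
  fixes n :: nat
  assumes "CHAR('a::local_field) \<noteq> 2"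
    and "n \<ge> 1"
  shows "minimal_topological_group (ST_plus n :: 'a mat monoid) (ST_plus_topology n)"
proof -
  obtain N where n: "n = Suc N" using assms(2) by (cases n) auto
  have two: "(2::'a) \<noteq> 0"
  proof
    assume "(2::'a) = 0"
    then have "CHAR('a) dvd 2" using of_nat_eq_0_iff_char_dvd[of 2, where 'a = 'a] by simp
    then have "CHAR('a) \<le> 2" by (rule dvd_imp_le) simp
    moreover have "CHAR('a) \<noteq> 1" using CHAR_not_1' by simp
    moreover have "CHAR('a) \<noteq> 0" using \<open>CHAR('a) dvd 2\<close> by (metis dvd_0_left zero_neq_numeral)
    ultimately show False using assms(1) by linarith
  qed
  have "\<not> strictly_coarser S (ST_plus_topology n)"
    if S: "hausdorff_group_topology (ST_plus n) S" for S :: "'a mat topology"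
  proof
    assume co: "strictly_coarser S (ST_plus_topology n)"
    \<comment> \<open>The inclusion in \<open>co\<close> feeds the locale; its strictness then
      contradicts \<open>openin_finer\<close>.\<close>
    interpret coarser_ST_plus N S
      by unfold_locales (use S co two in \<open>auto simp: n strictly_coarser_def\<close>)
    show False using co openin_finer by (auto simp: n strictly_coarser_def)
  qed
  then show ?thesis
    using group_ST_plus hausdorff_group_topology_ST_plus by (auto simp: minimal_topological_group_def)
qed

end
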